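(* Let $\mathcal N$ be one of the algebras $\langle\mathbb N;\mathrm{Suc}\rangle$, $\langle\mathbb N;+\rangle$, $\langle\mathbb N;+,\times\rangle$. For any $f\colon\mathbb N\to\mathbb N$ the following are equivalent: (1) $f$ is $\mathcal N$-stable-preorder preserving; (2) $f$ preserves every finite index $\mathcal N$-stable preorder; (3) $f$ is monotone non-decreasing and $\mathcal N$-congruence preserving; (4) $f$ is constant, or for every recognizable $L\subseteq\mathbb N$ the lattice $\mathrm{Latt}_{\mathrm{Suc}}(L)$ is closed under $f^{-1}$; (5) for every recognizable $L\subseteq\mathbb N$ the lattice $\mathrm{Latt}^{\emptyset,\mathbb N}_{\mathrm{Suc}}(L)$ is closed under $f^{-1}$; (6) (a) $|y-x|$ divides $|f(y)-f(x)|$ for all $x,y\in\mathbb N$, (b) $f$ is constant or $f(x)\ge x$ for all $x\in\mathbb N$, and (c) $f$ is monotone non-decreasing.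
   Context: A binary relation $\rho$ on $\mathbb N$ is $\mathcal N$-stable if it is compatible with each operation of $\mathcal N$ (i.e. $x_i\rho y_i$ for all arguments implies the values are $\rho$-related). $\mathcal N$-congruences are stable equivalence relations, $\mathcal N$-stable preorders are stable reflexive transitive relations; $f$ preserves a relation $\rho$ if $x\rho y$ implies $f(x)\rho f(y)$; $f$ is congruence (resp. stable-preorder) preserving if it preserves all $\mathcal N$-congruences (resp. $\mathcal N$-stable preorders). The index of a stable preorder $\sqsubseteq$ is the number of classes of the equivalence $\{(x,y): x\sqsubseteq y, y\sqsubseteq x\}$. A set $L\subseteq\mathbb N$ is recognizable if it is a union of classes of some finite index congruence of $\langle \mathbb N;\mathrm{Suc}\rangle$. $\mathrm{Latt}_{\mathrm{Suc}}(L)$ is the smallest family of subsets of $\mathbb N$ containing $L$, closed under finite (binary) unions and intersections and under $X\mapsto \mathrm{Suc}^{-1}(X)=\{z: z+1\in X\}$; $\mathrm{Latt}^{\emptyset,\mathbb N}_{\mathrm{Suc}}(L)$ is the smallest such family which moreover contains $\emptyset$ and $\mathbb N$. A family $\mathcal L$ is closed under $f^{-1}$ if $X\in\mathcal L$ implies $f^{-1}(X)\in\mathcal L$. *)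

theory Defs
  imports Main
begin

text \<open>
  An algebra on the natural numbers is given by its set of basic operations.  A pair
  \<open>(n, g)\<close> stands for an \<open>n\<close>-ary operation \<open>g\<close>, whose arguments are passed as a list;
  the values of \<open>g\<close> on lists of length other than \<open>n\<close> are irrelevant.
\<close>

type_synonym nat_algebra = "(nat \<times> (nat list \<Rightarrow> nat)) set"

definition suc_op :: "nat \<times> (nat list \<Rightarrow> nat)" where
  "suc_op = (1, \<lambda>xs. Suc (xs ! 0))"

definition add_op :: "nat \<times> (nat list \<Rightarrow> nat)" where
  "add_op = (2, \<lambda>xs. xs ! 0 + xs ! 1)"

definition mult_op :: "nat \<times> (nat list \<Rightarrow> nat)" where
  "mult_op = (2, \<lambda>xs. xs ! 0 * xs ! 1)"

definition stable :: "nat_algebra \<Rightarrow> nat rel \<Rightarrow> bool" where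
  "stable N r \<longleftrightarrow> (\<forall>(n, g) \<in> N. \<forall>xs ys. length xs = n \<and> length ys = n \<and>
     (\<forall>i<n. (xs ! i, ys ! i) \<in> r) \<longrightarrow> (g xs, g ys) \<in> r)"

definition congruence :: "nat_algebra \<Rightarrow> nat rel \<Rightarrow> bool" where
  "congruence N r \<longleftrightarrow> equiv UNIV r \<and> stable N r"

definition stable_preorder :: "nat_algebra \<Rightarrow> nat rel \<Rightarrow> bool" where
  "stable_preorder N r \<longleftrightarrow> refl r \<and> trans r \<and> stable N r"

definition preserves :: "(nat \<Rightarrow> nat) \<Rightarrow> nat rel \<Rightarrow> bool" where
  "preserves f r \<longleftrightarrow> (\<forall>x y. (x, y) \<in> r \<longrightarrow> (f x, f y) \<in> r)"

definition congruence_preserving :: "nat_algebra \<Rightarrow> (nat \<Rightarrow> nat) \<Rightarrow> bool" where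
  "congruence_preserving N f \<longleftrightarrow> (\<forall>r. congruence N r \<longrightarrow> preserves f r)"

definition stable_preorder_preserving :: "nat_algebra \<Rightarrow> (nat \<Rightarrow> nat) \<Rightarrow> bool" where
  "stable_preorder_preserving N f \<longleftrightarrow> (\<forall>r. stable_preorder N r \<longrightarrow> preserves f r)"

text \<open>The index is the number of classes of \<open>r \<inter> r\<inverse>\<close>; for an equivalence \<open>r\<close> this is \<open>r\<close> itself.\<close>

definition finite_index :: "nat rel \<Rightarrow> bool" where
  "finite_index r \<longleftrightarrow> finite (UNIV // (r \<inter> r\<inverse>))"

definition recognizable :: "nat set \<Rightarrow> bool" where
  "recognizable L \<longleftrightarrow>
     (\<exists>r. congruence {suc_op} r \<and> finite_index r \<and> (\<exists>C \<subseteq> UNIV // r. L = \<Union>C))"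

inductive_set Latt_Suc :: "nat set \<Rightarrow> nat set set" for L :: "nat set" where
  base: "L \<in> Latt_Suc L"
| union: "X \<in> Latt_Suc L \<Longrightarrow> Y \<in> Latt_Suc L \<Longrightarrow> X \<union> Y \<in> Latt_Suc L"
| inter: "X \<in> Latt_Suc L \<Longrightarrow> Y \<in> Latt_Suc L \<Longrightarrow> X \<inter> Y \<in> Latt_Suc L"
| suc_vimage: "X \<in> Latt_Suc L \<Longrightarrow> Suc -` X \<in> Latt_Suc L"

inductive_set bounded_Latt_Suc :: "nat set \<Rightarrow> nat set set" for L :: "nat set" where
  base: "L \<in> bounded_Latt_Suc L"
| empty: "{} \<in> bounded_Latt_Suc L"
| univ: "UNIV \<in> bounded_Latt_Suc L"
| union: "X \<in> bounded_Latt_Suc L \<Longrightarrow> Y \<in> bounded_Latt_Suc L \<Longrightarrow> X \<union> Y \<in> bounded_Latt_Suc L"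
| inter: "X \<in> bounded_Latt_Suc L \<Longrightarrow> Y \<in> bounded_Latt_Suc L \<Longrightarrow> X \<inter> Y \<in> bounded_Latt_Suc L"
| suc_vimage: "X \<in> bounded_Latt_Suc L \<Longrightarrow> Suc -` X \<in> bounded_Latt_Suc L"

definition closed_under_vimage :: "nat set set \<Rightarrow> (nat \<Rightarrow> nat) \<Rightarrow> bool" where
  "closed_under_vimage \<L> f \<longleftrightarrow> (\<forall>X \<in> \<L>. f -` X \<in> \<L>)"

definition constant_fun :: "(nat \<Rightarrow> nat) \<Rightarrow> bool" where
  "constant_fun f \<longleftrightarrow> (\<exists>c. \<forall>x. f x = c)"

definition all_equivalent :: "bool list \<Rightarrow> bool" where
  "all_equivalent Ps \<longleftrightarrow> (\<forall>P \<in> set Ps. \<forall>Q \<in> set Ps. P \<longleftrightarrow> Q)"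

end

theory Submission
  imports Defs
begin

text \<open>
  Every \<open>Suc\<close>-stable preorder is stable under addition and multiplication, so all three algebras
  have the same stable preorders.  If \<open>r\<close> is one and \<open>f\<close> is nonconstant and satisfies (6), then for
  \<open>y = x + k\<close> we have \<open>f x = x + a\<close> and \<open>f y = f x + m * k\<close>, so shifting \<open>(x, y) \<in> r\<close> by
  \<open>a\<close>, \<open>a + k\<close>, \<open>a + 2 * k\<close>, \dots relates \<open>f x\<close> to \<open>f y\<close>.  Conversely (6) is read off
  the congruences modulo \<open>k\<close>, the congruences identifying all numbers \<open>\<ge> n\<close>, and the order
  \<open>\<le>\<close> with all numbers \<open>\<ge> n\<close> identified, all of finite index.

  For the lattices, \<open>L\<close> is an up-set of its syntactic preorder
  \<open>{(x, y). \<forall>n. x + n \<in> L \<longrightarrow> y + n \<in> L}\<close>, whose principal up-sets are intersections of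
  shifts of \<open>L\<close>; if \<open>f\<close> preserves this preorder, then \<open>f -` L\<close> is a union of such up-sets.
  In the other direction, all members of the lattice generated by an up-set of a stable
  preorder are up-sets.
\<close>

subsection \<open>Stable preorders\<close>

lemma stable_suc_iff: "stable {suc_op} r \<longleftrightarrow> (\<forall>x y. (x, y) \<in> r \<longrightarrow> (Suc x, Suc y) \<in> r)"
proof
  assume st: "stable {suc_op} r"
  show "\<forall>x y. (x, y) \<in> r \<longrightarrow> (Suc x, Suc y) \<in> r"
  proof (intro allI impI)
    fix x y assume "(x, y) \<in> r"
    then show "(Suc x, Suc y) \<in> r"
      using st[unfolded stable_def suc_op_def, simplified, rule_format, of "[x]" "[y]"] by simp
  qed
qed (auto simp: stable_def suc_op_def)

lemma stable_add_iff:
  "stable {add_op} r \<longleftrightarrow> (\<forall>x y u v. (x, y) \<in> r \<longrightarrow> (u, v) \<in> r \<longrightarrow> (x + u, y + v) \<in> r)"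
proof
  assume st: "stable {add_op} r"
  show "\<forall>x y u v. (x, y) \<in> r \<longrightarrow> (u, v) \<in> r \<longrightarrow> (x + u, y + v) \<in> r"
  proof (intro allI impI)
    fix x y u v assume "(x, y) \<in> r" "(u, v) \<in> r"
    then show "(x + u, y + v) \<in> r"
      using st[unfolded stable_def add_op_def, simplified, rule_format, of "[x, u]" "[y, v]"]
      by (simp add: less_2_cases_iff)
  qed
qed (auto simp: stable_def add_op_def)

lemma stable_mult_iff:
  "stable {mult_op} r \<longleftrightarrow> (\<forall>x y u v. (x, y) \<in> r \<longrightarrow> (u, v) \<in> r \<longrightarrow> (x * u, y * v) \<in> r)"
proof
  assume st: "stable {mult_op} r"
  show "\<forall>x y u v. (x, y) \<in> r \<longrightarrow> (u, v) \<in> r \<longrightarrow> (x * u, y * v) \<in> r"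
  proof (intro allI impI)
    fix x y u v assume "(x, y) \<in> r" "(u, v) \<in> r"
    then show "(x * u, y * v) \<in> r"
      using st[unfolded stable_def mult_op_def, simplified, rule_format, of "[x, u]" "[y, v]"]
      by (simp add: less_2_cases_iff)
  qed
qed (auto simp: stable_def mult_op_def)

lemma stable_insert: "stable (insert p N) r \<longleftrightarrow> stable {p} r \<and> stable N r"
  by (auto simp: stable_def)

lemma stable_suc_add:
  assumes "stable {suc_op} r" "(x, y) \<in> r"
  shows "(x + n, y + n) \<in> r"
  using assms by (induction n) (auto simp: stable_suc_iff)

text \<open>Shifting the first pair by \<open>u\<close> and the second by \<open>y\<close> gives a
  chain from \<open>x + u\<close> through \<open>y + u\<close> to \<open>y + v\<close>.\<close>

lemma stable_preorder_suc_imp_stable_add: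
  assumes "stable_preorder {suc_op} r"
  shows "stable {add_op} r"
  unfolding stable_add_iff
proof (intro allI impI)
  fix x y u v assume xy: "(x, y) \<in> r" and uv: "(u, v) \<in> r"
  have "(x + u, y + u) \<in> r" "(u + y, v + y) \<in> r"
    using assms xy uv stable_suc_add by (auto simp: stable_preorder_def)
  then show "(x + u, y + v) \<in> r"
    using assms by (metis add.commute stable_preorder_def transE)
qed

text \<open>Multiplication by a fixed number is repeated addition; changing one factor at a time
  gives a chain through \<open>y * u\<close>.\<close>

lemma stable_preorder_suc_imp_stable_mult:
  assumes r: "stable_preorder {suc_op} r"
  shows "stable {mult_op} r"
  unfolding stable_mult_iff
proof (intro allI impI)
  fix x y u v assume xy: "(x, y) \<in> r" and uv: "(u, v) \<in> r"
  have *: "(n * a, n * b) \<in> r" if "(a, b) \<in> r" for a b n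
  proof (induction n)
    case 0
    then show ?case using r by (simp add: stable_preorder_def refl_on_def)
  next
    case (Suc n)
    then show ?case
      using stable_preorder_suc_imp_stable_add[OF r] that by (simp add: stable_add_iff)
  qed
  have "(x * u, y * u) \<in> r" "(y * u, y * v) \<in> r"
    using *[OF xy, of u] *[OF uv, of y] by (simp_all add: mult.commute)
  then show "(x * u, y * v) \<in> r"
    using r by (metis stable_preorder_def transE)
qed

lemma stable_preorder_eq_suc:
  assumes "N = {suc_op} \<or> N = {add_op} \<or> N = {add_op, mult_op}"
  shows "stable_preorder N r \<longleftrightarrow> stable_preorder {suc_op} r"
proof
  assume r: "stable_preorder N r"
  \<comment> \<open>Reflexivity supplies the pair \<open>(1, 1)\<close>, and adding it acts as the
    successor.\<close>
  have "(Suc x, Suc y) \<in> r" if "stable {add_op} r" "(x, y) \<in> r" for x y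
    using that r unfolding stable_add_iff stable_preorder_def refl_on_def
    by (metis Suc_eq_plus1 UNIV_I)
  then have "stable {add_op} r \<Longrightarrow> stable {suc_op} r"
    by (auto simp: stable_suc_iff)
  then show "stable_preorder {suc_op} r"
    using assms r stable_insert[of add_op "{mult_op}" r] by (auto simp: stable_preorder_def)
next
  assume r: "stable_preorder {suc_op} r"
  then show "stable_preorder N r"
    using assms stable_preorder_suc_imp_stable_add[OF r] stable_preorder_suc_imp_stable_mult[OF r]
      stable_insert[of add_op "{mult_op}" r]
    by (auto simp: stable_preorder_def)
qed

lemma congruence_iff: "congruence N r \<longleftrightarrow> stable_preorder N r \<and> sym r"
  by (auto simp: congruence_def stable_preorder_def equiv_def)

lemma congruence_symmetric_part:
  assumes "stable_preorder {suc_op} r"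
  shows "congruence {suc_op} (r \<inter> r\<inverse>)"
  using assms unfolding congruence_iff stable_preorder_def stable_suc_iff
  by (auto simp: refl_on_def sym_def intro!: transI dest: transD)

lemma finite_indexI:
  assumes r: "refl r" "trans r" and n: "\<And>x. \<exists>y\<le>n. (x, y) \<in> r \<and> (y, x) \<in> r"
  shows "finite_index r"
proof -
  let ?e = "r \<inter> r\<inverse>"
  have e: "equiv UNIV ?e"
    using r by (auto simp: equiv_def refl_on_def sym_def intro!: transI dest: transD)
  have "UNIV // ?e \<subseteq> (\<lambda>x::nat. ?e `` {x}) ` {..n}"
  proof
    fix X assume "X \<in> UNIV // ?e"
    then obtain x where x: "X = ?e `` {x}" by (auto elim: quotientE)
    obtain y where "y \<le> n" "(x, y) \<in> ?e" using n[of x] by auto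
    moreover have "X = ?e `` {y}" unfolding x by (rule equiv_class_eq[OF e]) fact
    ultimately show "X \<in> (\<lambda>x. ?e `` {x}) ` {..n}" by blast
  qed
  then show ?thesis unfolding finite_index_def by (rule finite_subset) simp
qed

subsection \<open>Functions satisfying the arithmetic condition\<close>

lemma mono_dvd_diffE:
  fixes f :: "nat \<Rightarrow> nat"
  assumes "\<bar>int y - int x\<bar> dvd \<bar>int (f y) - int (f x)\<bar>" "mono f" "x \<le> y"
  obtains m where "f y = f x + m * (y - x)"
proof -
  have "f x \<le> f y" using assms by (simp add: monoD)
  then have "int (y - x) dvd int (f y - f x)" using assms by (simp add: of_nat_diff)
  then have "y - x dvd f y - f x" by (simp only: int_dvd_int_iff)
  then obtain m where "f y - f x = (y - x) * m" by (auto elim: dvdE)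
  then show thesis using \<open>f x \<le> f y\<close> by (intro that[of m]) (simp add: mult.commute)
qed

lemma preserves_stable_preorder:
  assumes r: "stable_preorder {suc_op} r"
    and dvd: "\<forall>x y. \<bar>int y - int x\<bar> dvd \<bar>int (f y) - int (f x)\<bar>"
    and ge: "constant_fun f \<or> (\<forall>x. f x \<ge> x)" and mono: "mono f"
  shows "preserves f r"
proof (cases "constant_fun f")
  case True
  then show ?thesis using r
    by (metis UNIV_I constant_fun_def preserves_def refl_on_def stable_preorder_def)
next
  case False
  have ref: "(z, z) \<in> r" for z using r by (simp add: stable_preorder_def refl_on_def)
  have tr: "trans r" and st: "stable {suc_op} r" using r by (auto simp: stable_preorder_def)
  show ?thesis
    unfolding preserves_def
  proof (intro allI impI)
    fix x y assume xy: "(x, y) \<in> r"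
    show "(f x, f y) \<in> r"
    proof (cases "x \<le> y")
      case True
      obtain m where m: "f y = f x + m * (y - x)"
        using mono_dvd_diffE[OF dvd[rule_format] mono True] .
      have "x \<le> f x" using ge False by blast
      have "(f x, f x + i * (y - x)) \<in> r" for i
      proof (induction i)
        case (Suc i)
        \<comment> \<open>The truncated difference \<open>f x - x\<close> is exact because
          \<open>x \<le> f x\<close>. Shifting by it moves \<open>x\<close> to \<open>f x\<close>,
          and each further step of length \<open>y - x\<close> starts where the previous one
          ended.\<close>
        have "(x + (f x - x + i * (y - x)), y + (f x - x + i * (y - x))) \<in> r"
          by (rule stable_suc_add[OF st xy])
        moreover have "x + (f x - x + i * (y - x)) = f x + i * (y - x)"
          "y + (f x - x + i * (y - x)) = f x + Suc i * (y - x)"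
          using \<open>x \<le> f x\<close> \<open>x \<le> y\<close> by simp_all
        ultimately have "(f x + i * (y - x), f x + Suc i * (y - x)) \<in> r"
          by simp
        with Suc show ?case by (rule transD[OF tr])
      qed (simp add: ref)
      then show ?thesis by (simp add: m)
    next
      case False
      then have "y \<le> x" by simp
      obtain m where m: "f x = f y + m * (x - y)"
        using mono_dvd_diffE[OF dvd[rule_format] mono \<open>y \<le> x\<close>] .
      have "y \<le> f y" using ge \<open>\<not> constant_fun f\<close> by blast
      \<comment> \<open>Now \<open>r\<close> relates a larger number to a smaller one, so the chain
        descends to \<open>f y\<close> and is extended at its upper end.\<close>
      have "(f y + i * (x - y), f y) \<in> r" for i
      proof (induction i)
        case (Suc i)
        have "(x + (f y - y + i * (x - y)), y + (f y - y + i * (x - y))) \<in> r"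
          by (rule stable_suc_add[OF st xy])
        moreover have "x + (f y - y + i * (x - y)) = f y + Suc i * (x - y)"
          "y + (f y - y + i * (x - y)) = f y + i * (x - y)"
          using \<open>y \<le> f y\<close> \<open>y \<le> x\<close> by simp_all
        ultimately have "(f y + Suc i * (x - y), f y + i * (x - y)) \<in> r"
          by simp
        then show ?case using Suc by (rule transD[OF tr])
      qed (simp add: ref)
      then show ?thesis by (simp add: m)
    qed
  qed
qed

section \<open>The arithmetic condition derived from finite index relations\<close>

text \<open>Distinct \<open>x\<close> and \<open>y\<close> are congruent modulo their distance,
  hence so are \<open>f x\<close> and \<open>f y\<close>. The modulus is positive, so residues are
  bounded and the index is finite.\<close>

lemma dvd_diff_if_preserves_finite_index:
  assumes f: "\<And>r. congruence {suc_op} r \<Longrightarrow> finite_index r \<Longrightarrow> preserves f r"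
  shows "\<bar>int y - int x\<bar> dvd \<bar>int (f y) - int (f x)\<bar>"
proof (cases "x = y")
  case False
  define k where "k = nat \<bar>int y - int x\<bar>"
  have k: "int k = \<bar>int y - int x\<bar>" "k > 0" using False by (auto simp: k_def)
  let ?r = "{(u, v). u mod k = v mod k}"
  have c: "congruence {suc_op} ?r"
    unfolding congruence_iff stable_preorder_def stable_suc_iff
    by (auto simp: refl_on_def sym_def trans_def mod_Suc)
  have "finite_index ?r"
  proof (rule finite_indexI)
    show "\<exists>v\<le>k. (u, v) \<in> ?r \<and> (v, u) \<in> ?r" for u
      using k by (intro exI[of _ "u mod k"]) (simp add: less_imp_le)
  qed (use c in \<open>auto simp: congruence_iff stable_preorder_def\<close>)
  with c have "preserves f ?r" by (rule f)
  moreover have mod_eq: "u mod k = v mod k \<longleftrightarrow> int k dvd int u - int v" for u v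
    by (metis mod_eq_dvd_iff of_nat_eq_iff of_nat_mod)
  have "y mod k = x mod k" unfolding mod_eq k by simp
  ultimately have "f y mod k = f x mod k" unfolding preserves_def by blast
  then show ?thesis unfolding mod_eq k by simp
qed simp

text \<open>If \<open>f n < n\<close>, then \<open>f\<close> takes the value \<open>f n\<close> at every argument \<open>\<ge> n\<close>, so
  \<open>f x - f n\<close> has arbitrarily large divisors for every \<open>x\<close>.\<close>

lemma constant_or_ge_if_preserves_finite_index:
  assumes f: "\<And>r. congruence {suc_op} r \<Longrightarrow> finite_index r \<Longrightarrow> preserves f r"
  shows "constant_fun f \<or> (\<forall>x. f x \<ge> x)"
proof (rule disjCI)
  assume "\<not> (\<forall>x. f x \<ge> x)"
  then obtain n where n: "f n < n" by (auto simp: not_le)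
  let ?r = "{(u, v). u = v \<or> n \<le> u \<and> n \<le> v}"
  have c: "congruence {suc_op} ?r"
    unfolding congruence_iff stable_preorder_def stable_suc_iff
    by (auto simp: refl_on_def sym_def trans_def)
  have "finite_index ?r"
  proof (rule finite_indexI)
    show "\<exists>v\<le>n. (u, v) \<in> ?r \<and> (v, u) \<in> ?r" for u
      by (intro exI[of _ "min u n"]) auto
  qed (use c in \<open>auto simp: congruence_iff stable_preorder_def\<close>)
  with c have "preserves f ?r" by (rule f)
  \<comment> \<open>As \<open>f n < n\<close>, the class of \<open>f n\<close> is a
    singleton.\<close>
  then have const: "f z = f n" if "z \<ge> n" for z
    using that n by (fastforce simp: preserves_def)
  have "f x = f n" for x
  proof (rule ccontr)
    assume ne: "f x \<noteq> f n"
    \<comment> \<open>This \<open>z\<close> lies beyond \<open>n\<close>, and \<open>z - x\<close>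
      exceeds the distance of \<open>f x\<close> and \<open>f n\<close>.\<close>
    define z where "z = n + x + f x + f n + 1"
    have "\<bar>int z - int x\<bar> dvd \<bar>int (f z) - int (f x)\<bar>"
      by (rule dvd_diff_if_preserves_finite_index[OF f])
    moreover have "f z = f n" by (rule const) (simp add: z_def)
    ultimately have "\<bar>int z - int x\<bar> \<le> \<bar>int (f n) - int (f x)\<bar>"
      using ne by (intro zdvd_imp_le) auto
    then show False by (simp add: z_def)
  qed
  then show "constant_fun f" by (auto simp: constant_fun_def)
qed

lemma mono_if_preserves_finite_index:
  assumes f: "\<And>r. stable_preorder {suc_op} r \<Longrightarrow> finite_index r \<Longrightarrow> preserves f r"
  shows "mono f"
proof
  fix x y :: nat assume "x \<le> y"
  \<comment> \<open>The plain order has infinite index, so its upper end is collapsed; this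
    threshold keeps \<open>f x\<close> below the collapsed part, where the relation is still the
    order.\<close>
  define n where "n = Suc (f x)"
  let ?r = "{(u, v). u \<le> v \<or> n \<le> u \<and> n \<le> v}"
  have c: "stable_preorder {suc_op} ?r"
    unfolding stable_preorder_def stable_suc_iff by (auto simp: refl_on_def trans_def)
  have "finite_index ?r"
  proof (rule finite_indexI)
    show "\<exists>v\<le>n. (u, v) \<in> ?r \<and> (v, u) \<in> ?r" for u
      by (intro exI[of _ "min u n"]) auto
  qed (use c in \<open>auto simp: stable_preorder_def\<close>)
  with c have "preserves f ?r" by (rule f)
  with \<open>x \<le> y\<close> have "(f x, f y) \<in> ?r" by (auto simp: preserves_def)
  then show "f x \<le> f y" by (simp add: n_def)
qed

subsection \<open>Lattices generated by a recognizable set\<close>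

text \<open>Index sets are nonempty here because \<open>Latt_Suc L\<close> may lack the empty set or
  \<open>UNIV\<close>.\<close>

lemma Latt_Suc_UN:
  assumes "finite I" "I \<noteq> {}" "\<And>i. i \<in> I \<Longrightarrow> S i \<in> Latt_Suc L"
  shows "(\<Union>i\<in>I. S i) \<in> Latt_Suc L"
  using assms by (induction rule: finite_ne_induct) (auto intro: Latt_Suc.union)

lemma Latt_Suc_INT:
  assumes "finite I" "I \<noteq> {}" "\<And>i. i \<in> I \<Longrightarrow> S i \<in> Latt_Suc L"
  shows "(\<Inter>i\<in>I. S i) \<in> Latt_Suc L"
  using assms by (induction rule: finite_ne_induct) (auto intro: Latt_Suc.inter)

lemma shift_in_Latt_Suc: "{x. x + n \<in> L} \<in> Latt_Suc L"
proof (induction n)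
  case (Suc n)
  have "{x. x + Suc n \<in> L} = Suc -` {x. x + n \<in> L}" by auto
  also have "\<dots> \<in> Latt_Suc L" using Suc by (rule Latt_Suc.suc_vimage)
  finally show ?case .
qed (simp add: Latt_Suc.base)

text \<open>Stability makes every shift of \<open>L\<close> a union of classes of the same finite
  index congruence, and there are only finitely many such unions.\<close>

lemma finite_shifts:
  assumes "recognizable L"
  shows "finite (range (\<lambda>n. {x. x + n \<in> L}))"
proof -
  obtain r C where r: "congruence {suc_op} r" "finite_index r" and C: "C \<subseteq> UNIV // r" "L = \<Union>C"
    using assms by (auto simp: recognizable_def)
  have e: "equiv UNIV r" and st: "stable {suc_op} r"
    using r by (auto simp: congruence_def)
  have "r \<inter> r\<inverse> = r" using e by (auto simp: equiv_def dest: symD)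
  then have fin: "finite (UNIV // r)" using r by (simp add: finite_index_def)
  have sat: "v \<in> L" if uv: "(u, v) \<in> r" and "u \<in> L" for u v
  proof -
    obtain X where X: "X \<in> C" "u \<in> X" using \<open>u \<in> L\<close> C by blast
    then have "v \<in> X" using in_quotient_imp_closed[OF e _ _ uv] C by blast
    then show ?thesis using X C by auto
  qed
  have "{x. x + n \<in> L} \<in> Union ` Pow (UNIV // r)" for n
  proof (rule image_eqI)
    have "u + n \<in> L" if "(x, u) \<in> r" "x + n \<in> L" for x u
      using sat that stable_suc_add[OF st] by blast
    then show "{x. x + n \<in> L} = \<Union> ((\<lambda>x. r `` {x}) ` {x. x + n \<in> L})"
      using e by (auto simp: equiv_def refl_on_def)
  qed (auto intro: quotientI)
  then have "range (\<lambda>n. {x. x + n \<in> L}) \<subseteq> Union ` Pow (UNIV // r)" by auto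
  then show ?thesis using fin by (meson finite_Pow_iff finite_imageI finite_subset)
qed

text \<open>An infinite \<open>I\<close> is harmless, since only finitely many distinct shifts
  occur.\<close>

lemma INT_shifts_in_Latt_Suc:
  assumes "recognizable L" "I \<noteq> {}"
  shows "(\<Inter>n\<in>I. {x. x + n \<in> L}) \<in> Latt_Suc L"
proof -
  have "finite ((\<lambda>n. {x. x + n \<in> L}) ` I)"
    using finite_shifts[OF assms(1)] by (rule finite_subset[rotated]) auto
  then have "(\<Inter>X\<in>(\<lambda>n. {x. x + n \<in> L}) ` I. X) \<in> Latt_Suc L"
    by (rule Latt_Suc_INT) (use assms shift_in_Latt_Suc in auto)
  then show ?thesis by simp
qed

lemma vimage_generator_in_Latt_Suc:
  assumes L: "recognizable L" and ge: "\<And>x. f x \<ge> x"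
    and pres: "\<And>r. stable_preorder {suc_op} r \<Longrightarrow> preserves f r"
  shows "f -` L \<in> Latt_Suc L"
proof (cases "f -` L = {}")
  case True
  text \<open>The intersection of all shifts of \<open>L\<close> is empty, since otherwise \<open>L\<close> contains all numbers
    from some \<open>m\<close> on, among them \<open>f m\<close>.\<close>
  have "(\<Inter>n. {x. x + n \<in> L}) = {}"
  proof (rule ccontr)
    assume "(\<Inter>n. {x. x + n \<in> L}) \<noteq> {}"
    then obtain m where "\<And>n. m + n \<in> L" by auto
    then have "f m \<in> L" using ge[of m] by (metis le_add_diff_inverse)
    with True show False by auto
  qed
  then show ?thesis using INT_shifts_in_Latt_Suc[OF L, of UNIV] True by simp
next
  case False
  define r where "r = {(x, y). \<forall>n. x + n \<in> L \<longrightarrow> y + n \<in> L}"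
  \<comment> \<open>This is the principal up-set of \<open>a\<close> for the syntactic preorder
    \<open>r\<close>.\<close>
  define M where "M a = (\<Inter>n\<in>{n. a + n \<in> L}. {x. x + n \<in> L})" for a
  have "stable_preorder {suc_op} r"
    unfolding stable_preorder_def stable_suc_iff r_def
    by (auto simp: refl_on_def trans_def simp flip: add_Suc_right)
  then have f: "(f x, f y) \<in> r" if "(x, y) \<in> r" for x y
    using that pres by (auto simp: preserves_def)
  have eq: "f -` L = (\<Union>a\<in>f -` L. M a)"
  proof (intro equalityI subsetI)
    fix x assume "x \<in> (\<Union>a\<in>f -` L. M a)"
    then obtain a where a: "f a \<in> L" "(a, x) \<in> r" by (auto simp: M_def r_def)
    then have "(f a, f x) \<in> r" using f by blast
    then have "f a + 0 \<in> L \<longrightarrow> f x + 0 \<in> L" unfolding r_def by blast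
    then show "x \<in> f -` L" using a by simp
  qed (auto simp: M_def)
  \<comment> \<open>Each \<open>M a\<close> intersects a subfamily of the finitely many shifts, so
    the union over \<open>a\<close> has only finitely many distinct members.\<close>
  have "M a \<in> (\<lambda>S. \<Inter>S) ` Pow (range (\<lambda>n. {x. x + n \<in> L}))" for a
    unfolding M_def by (rule image_eqI[OF refl]) auto
  then have "M ` (f -` L) \<subseteq> (\<lambda>S. \<Inter>S) ` Pow (range (\<lambda>n. {x. x + n \<in> L}))"
    by (intro image_subsetI)
  then have "finite (M ` (f -` L))"
    by (rule finite_subset) (use finite_shifts[OF L] in simp)
  moreover have "M a \<in> Latt_Suc L" if "a \<in> f -` L" for a
  proof -
    \<comment> \<open>The inequality \<open>f a \<ge> a\<close> enters here: \<open>f a - a\<close>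
      witnesses that the intersection is over a nonempty index set.\<close>
    have "a + (f a - a) \<in> L" using that ge[of a] by simp
    then show ?thesis unfolding M_def by (intro INT_shifts_in_Latt_Suc L) blast
  qed
  ultimately have "(\<Union>X\<in>M ` (f -` L). X) \<in> Latt_Suc L"
    using False by (intro Latt_Suc_UN) auto
  then show ?thesis using eq by simp
qed

lemma closed_under_vimage_Latt_Suc:
  assumes L: "recognizable L" and ge: "\<And>x. f x \<ge> x"
    and pres: "\<And>r. stable_preorder {suc_op} r \<Longrightarrow> preserves f r"
  shows "closed_under_vimage (Latt_Suc L) f"
  unfolding closed_under_vimage_def
proof
  fix X assume "X \<in> Latt_Suc L"
  then show "f -` X \<in> Latt_Suc L"
    using ge pres
  \<comment> \<open>The function must vary: pulling a \<open>Suc\<close>-preimage of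
    \<open>X\<close> back along \<open>f\<close> is pulling \<open>X\<close> back along
    \<open>Suc\<close> after \<open>f\<close>, which satisfies the same hypotheses.\<close>
  proof (induction arbitrary: f)
    case base
    then show ?case by (intro vimage_generator_in_Latt_Suc L)
  next
    case (suc_vimage X)
    have "(\<lambda>x. Suc (f x)) -` X \<in> Latt_Suc L"
    proof (rule suc_vimage.IH)
      show "Suc (f x) \<ge> x" for x using suc_vimage.prems(1)[of x] by simp
      show "preserves (\<lambda>x. Suc (f x)) r" if "stable_preorder {suc_op} r" for r
        using suc_vimage.prems(2)[OF that] that
        by (auto simp: preserves_def stable_preorder_def stable_suc_iff)
    qed
    then show ?case by (simp add: vimage_def)
  qed (auto intro: Latt_Suc.union Latt_Suc.inter)
qed

section \<open>Adjoining the empty set and \<open>UNIV\<close>\<close>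

lemma Latt_Suc_subset_bounded: "Latt_Suc L \<subseteq> bounded_Latt_Suc L"
proof
  show "X \<in> bounded_Latt_Suc L" if "X \<in> Latt_Suc L" for X
    using that by induction (auto intro: bounded_Latt_Suc.intros)
qed

text \<open>The two bounds are fixed by \<open>Suc\<close>-preimage and are neutral or absorbing for
  union and intersection, so adjoining them creates nothing else.\<close>

lemma bounded_Latt_Suc_cases:
  assumes "X \<in> bounded_Latt_Suc L"
  shows "X = {} \<or> X = UNIV \<or> X \<in> Latt_Suc L"
  using assms by induction (auto intro: Latt_Suc.intros)

lemma closed_under_vimage_bounded_constant:
  assumes "constant_fun f"
  shows "closed_under_vimage (bounded_Latt_Suc L) f"
proof -
  obtain c where "f = (\<lambda>x. c)" using assms by (auto simp: constant_fun_def)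
  then show ?thesis
    by (auto simp: closed_under_vimage_def
        intro: bounded_Latt_Suc.empty bounded_Latt_Suc.univ)
qed

lemma closed_under_vimage_bounded:
  assumes "closed_under_vimage (Latt_Suc L) f"
  shows "closed_under_vimage (bounded_Latt_Suc L) f"
  unfolding closed_under_vimage_def
proof
  fix X assume "X \<in> bounded_Latt_Suc L"
  then consider "X = {}" | "X = UNIV" | "X \<in> Latt_Suc L"
    using bounded_Latt_Suc_cases by blast
  then show "f -` X \<in> bounded_Latt_Suc L"
  proof cases
    case 3
    then have "f -` X \<in> Latt_Suc L" using assms by (simp add: closed_under_vimage_def)
    then show ?thesis by (rule subsetD[OF Latt_Suc_subset_bounded])
  qed (simp_all add: bounded_Latt_Suc.empty bounded_Latt_Suc.univ)
qed

section \<open>From lattice closure back to preorders\<close>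

lemma bounded_Latt_Suc_upset:
  assumes "X \<in> bounded_Latt_Suc L" "stable {suc_op} r" "r `` L \<subseteq> L"
  shows "r `` X \<subseteq> X"
  using assms
proof induction
  case (suc_vimage X)
  then have "Suc y \<in> X" if "(x, y) \<in> r" "Suc x \<in> X" for x y
    using that by (auto simp: stable_suc_iff)
  then show ?case by auto
qed blast+

text \<open>By transitivity an up-set is saturated for the symmetric part of \<open>r\<close>, which
  is a congruence of the same index.\<close>

lemma recognizable_principal_upset:
  assumes r: "stable_preorder {suc_op} r" and fin: "finite_index r"
  shows "recognizable (r `` {a})"
  unfolding recognizable_def
proof (intro exI conjI)
  let ?e = "r \<inter> r\<inverse>"
  show "congruence {suc_op} ?e" by (rule congruence_symmetric_part[OF r])
  show "finite_index ?e"
    using fin by (simp add: finite_index_def converse_Int Int_ac)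
  show "(\<lambda>x. ?e `` {x}) ` (r `` {a}) \<subseteq> UNIV // ?e" by (auto intro: quotientI)
  show "r `` {a} = \<Union> ((\<lambda>x. ?e `` {x}) ` (r `` {a}))"
    using r by (auto simp: stable_preorder_def refl_on_def dest: transD)
qed

text \<open>For \<open>L\<close> the principal up-set of \<open>f x\<close>, the preimage of
  \<open>L\<close> under \<open>f\<close> is an up-set containing \<open>x\<close>, so it contains
  every \<open>y\<close> above \<open>x\<close>.\<close>

lemma preserves_if_closed_under_vimage:
  assumes cl: "\<And>L. recognizable L \<Longrightarrow> closed_under_vimage (bounded_Latt_Suc L) f"
    and r: "stable_preorder {suc_op} r" and fin: "finite_index r"
  shows "preserves f r"
  unfolding preserves_def
proof (intro allI impI)
  fix x y assume xy: "(x, y) \<in> r"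
  let ?L = "r `` {f x}"
  have "f -` ?L \<in> bounded_Latt_Suc ?L"
    using cl[OF recognizable_principal_upset[OF r fin]] bounded_Latt_Suc.base
    by (auto simp: closed_under_vimage_def)
  then have "r `` (f -` ?L) \<subseteq> f -` ?L"
    by (rule bounded_Latt_Suc_upset) (use r in \<open>auto simp: stable_preorder_def dest: transD\<close>)
  moreover have "x \<in> f -` ?L" using r by (simp add: stable_preorder_def refl_on_def)
  ultimately show "(f x, f y) \<in> r" using xy by blast
qed

theorem theorem3p14:
  fixes N :: nat_algebra and f :: "nat \<Rightarrow> nat"
  assumes "N = {suc_op} \<or> N = {add_op} \<or> N = {add_op, mult_op}"
  shows "all_equivalent
    [stable_preorder_preserving N f,
     \<forall>r. stable_preorder N r \<and> finite_index r \<longrightarrow> preserves f r,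
     mono f \<and> congruence_preserving N f,
     constant_fun f \<or> (\<forall>L. recognizable L \<longrightarrow> closed_under_vimage (Latt_Suc L) f),
     \<forall>L. recognizable L \<longrightarrow> closed_under_vimage (bounded_Latt_Suc L) f,
     (\<forall>x y. \<bar>int y - int x\<bar> dvd \<bar>int (f y) - int (f x)\<bar>)
       \<and> (constant_fun f \<or> (\<forall>x. f x \<ge> x))
       \<and> mono f]"
    (is "all_equivalent [?P1, ?P2, ?P3, ?P4, ?P5, ?P6]")
proof -
  note N = stable_preorder_eq_suc[OF assms]
  have cong: "congruence N r \<longleftrightarrow> congruence {suc_op} r" for r
    by (simp add: congruence_iff N)
  \<comment> \<open>The implications close two cycles through (6): 1, 3, 6, 1 and 6, 4, 5, 2,
    6.\<close>
  have "?P1 \<Longrightarrow> ?P3"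
  proof -
    assume P1: ?P1
    have "mono f"
      by (rule mono_if_preserves_finite_index)
        (use P1 N in \<open>auto simp: stable_preorder_preserving_def\<close>)
    moreover have "congruence_preserving N f"
      using P1 by (auto simp: stable_preorder_preserving_def congruence_preserving_def congruence_iff)
    ultimately show ?P3 ..
  qed
  moreover have "?P3 \<Longrightarrow> ?P6"
    using dvd_diff_if_preserves_finite_index[of f] constant_or_ge_if_preserves_finite_index[of f]
    by (auto simp: congruence_preserving_def cong)
  moreover have "?P6 \<Longrightarrow> ?P1"
    using preserves_stable_preorder[of _ f] by (auto simp: stable_preorder_preserving_def N)
  moreover have "?P6 \<Longrightarrow> ?P4"
    using preserves_stable_preorder[of _ f] closed_under_vimage_Latt_Suc[of _ f] by auto
  moreover have "?P4 \<Longrightarrow> ?P5"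
    using closed_under_vimage_bounded closed_under_vimage_bounded_constant by blast
  moreover have "?P5 \<Longrightarrow> ?P2"
    using preserves_if_closed_under_vimage[of f] by (auto simp: N)
  moreover have "?P2 \<Longrightarrow> ?P6"
    using dvd_diff_if_preserves_finite_index[of f] constant_or_ge_if_preserves_finite_index[of f]
      mono_if_preserves_finite_index[of f]
    by (auto simp: N congruence_iff)
  moreover have "?P1 \<Longrightarrow> ?P2" by (auto simp: stable_preorder_preserving_def)
  ultimately have "?P1 = ?P6" "?P2 = ?P6" "?P3 = ?P6" "?P4 = ?P6" "?P5 = ?P6"
    by argo+
  then show ?thesis
    unfolding all_equivalent_def by simp
qed

end
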